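(* Let $q$ be a prime power, $r\ge 0$ an integer, $V=\mathbb F_q^r$, let $D\subseteq\mathbb P(V)$ be a set of points, put $E=\mathbb P(V)\setminus D$, and let $M$ be the matroid represented by $E$. Assume that $E$ spans $V$ and that \[ \deg C_U(t)<\frac{r-\dim U}{2} \] for every flat span $U<V$ (that is, every flat span $U\neq V$). Then \[ P_{M/F_U}(t)=C_U(t) \] for every flat $F_U$ of $M$ (that is, for every flat span $U$). Moreover, \[ Z_M(t)=\sum_{j=0}^{r}\binom{r}{j}_{q}t^j . \]
   Context: Kazhdan--Lusztig polynomials. For a (finite) loopless matroid $M$, $L(M)$ is its lattice of flats, $\operatorname{rk}_M$ its rank function, and $M/F$ is the contraction by a flat $F$. The Kazhdan--Lusztig polynomials $P_M(t)\in\mathbb Z[t]$ are the unique family, indexed by loopless matroids $M$, such that: (i) $P_M(t)=1$ if $\operatorname{rk} M=0$; (ii) $\deg P_M(t)<\operatorname{rk} M/2$ if $\operatorname{rk} M>0$; (iii) for every $M$ the polynomial $Z_M(t)=\sum_{F\in L(M)}t^{\operatorname{rk}_M(F)}P_{M/F}(t)$ is palindromic of degree $\operatorname{rk} M$, i.e. $t^{\operatorname{rk} M}Z_M(t^{-1})=Z_M(t)$. The polynomial $Z_M(t)$ is called the $Z$-polynomial of $M$. Projective points. $\mathbb P(V)$ denotes the set of one-dimensional subspaces of $V$; for a subspace $A\le V$, $\mathbb P(A)\subseteq\mathbb P(V)$ is the set of one-dimensional subspaces of $A$ (so $\mathbb P(0)=\varnothing$). A set $E\subseteq\mathbb P(V)$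 represents a matroid on ground set $E$: the rank of a set of projective points is the dimension of their linear span. Flat spans. A subspace $U\le V$ is a flat span if $E\cap\mathbb P(U)$ spans $U$; the corresponding flat of $M$ is $F_U=E\cap\mathbb P(U)$. Every flat of $M$ is $F_U$ for the unique flat span $U$ equal to its linear span. Subspace polynomial. For a flat span $U$, \[ C_U(t)=\sum_{\substack{U\le A\le V\\ \mathbb P(A)\setminus\mathbb P(U)\subseteq D}}t^{\dim A-\dim U}, \] the sum being over subspaces $A$ of $V$ containing $U$. Gaussian binomial. $\binom{m}{j}_{q}=\prod_{i=0}^{j-1}\frac{q^{m-i}-1}{q^{j-i}-1}$, the number of $j$-dimensional subspaces of $\mathbb F_q^m$. *)

theory Defs
  imports
    Complex_Main
    "HOL-Library.Cardinality"
    "HOL-Library.Function_Algebras"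
    "HOL-Computational_Algebra.Polynomial"
begin

section \<open>Matroids\<close>

record 'a matroid =
  ground :: "'a set"
  rk :: "'a set \<Rightarrow> nat"

text \<open>
  The rank function only matters on subsets of the ground set; requiring
  \<open>rk M X = rk M (X \<inter> ground M)\<close> everywhere makes the record representing a matroid unique.
\<close>

definition is_matroid :: "'a matroid \<Rightarrow> bool" where
  "is_matroid M \<longleftrightarrow>
     finite (ground M) \<and>
     (\<forall>X. rk M X = rk M (X \<inter> ground M)) \<and>
     (\<forall>X. X \<subseteq> ground M \<longrightarrow> rk M X \<le> card X) \<and>
     (\<forall>X Y. X \<subseteq> Y \<and> Y \<subseteq> ground M \<longrightarrow> rk M X \<le> rk M Y) \<and>
     (\<forall>X Y. X \<subseteq> ground M \<and> Y \<subseteq> ground M \<longrightarrow>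
        rk M (X \<union> Y) + rk M (X \<inter> Y) \<le> rk M X + rk M Y)"

definition loopless :: "'a matroid \<Rightarrow> bool" where
  "loopless M \<longleftrightarrow> (\<forall>x\<in>ground M. rk M {x} \<noteq> 0)"

definition mrank :: "'a matroid \<Rightarrow> nat" where
  "mrank M = rk M (ground M)"

definition flats :: "'a matroid \<Rightarrow> 'a set set" where
  "flats M = {F. F \<subseteq> ground M \<and> (\<forall>x\<in>ground M - F. rk M F < rk M (insert x F))}"

definition contract :: "'a matroid \<Rightarrow> 'a set \<Rightarrow> 'a matroid" where
  "contract M F = \<lparr>ground = ground M - F, rk = (\<lambda>X. rk M (X \<union> F) - rk M F)\<rparr>"

section \<open>Kazhdan--Lusztig polynomials\<close>

text \<open>The identity \<open>t\<^sup>n p(t\<^sup>-\<^sup>1) = p(t)\<close>.\<close>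

definition palindromic :: "nat \<Rightarrow> int poly \<Rightarrow> bool" where
  "palindromic n p \<longleftrightarrow>
     (\<forall>t::rat. t \<noteq> 0 \<longrightarrow>
        t ^ n * poly (map_poly of_int p) (inverse t) = poly (map_poly of_int p) t)"

definition Z_of :: "('a matroid \<Rightarrow> int poly) \<Rightarrow> 'a matroid \<Rightarrow> int poly" where
  "Z_of P M = (\<Sum>F\<in>flats M. monom 1 (rk M F) * P (contract M F))"

definition KL_family :: "('a matroid \<Rightarrow> int poly) \<Rightarrow> bool" where
  "KL_family P \<longleftrightarrow>
     (\<forall>M. is_matroid M \<and> loopless M \<longrightarrow>
        (mrank M = 0 \<longrightarrow> P M = 1) \<and>
        (mrank M > 0 \<longrightarrow> real (degree (P M)) < real (mrank M) / 2) \<and>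
        palindromic (mrank M) (Z_of P M))"

text \<open>
  A Kazhdan--Lusztig family is only determined on loopless matroids; the value \<open>0\<close> on all other
  records makes it unique as a function (see \<open>KL_family_unique_existence\<close> below).
\<close>

definition KL_poly :: "'a matroid \<Rightarrow> int poly" where
  "KL_poly = (THE P. KL_family P \<and> (\<forall>M. \<not> (is_matroid M \<and> loopless M) \<longrightarrow> P M = 0))"

definition Z_poly :: "'a matroid \<Rightarrow> int poly" where
  "Z_poly M = Z_of KL_poly M"

subsection \<open>Existence and uniqueness\<close>

lemma poly_of_int_sum:
  fixes x :: rat
  assumes "degree p \<le> m"
  shows "poly (map_poly of_int p) x = (\<Sum>i\<le>m. of_int (coeff p i) * x ^ i)"
proof -
  have "degree (map_poly (of_int :: int \<Rightarrow> rat) p) \<le> m"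
    using assms map_poly_degree_leq[of "of_int :: int \<Rightarrow> rat" p] by linarith
  then have "map_poly of_int p = (\<Sum>i\<le>m. monom (coeff (map_poly of_int p) i :: rat) i)"
    by (simp only: poly_as_sum_of_monoms')
  then have "poly (map_poly of_int p) x
      = poly (\<Sum>i\<le>m. monom (coeff (map_poly of_int p) i :: rat) i) x"
    by (rule arg_cong)
  then show ?thesis
    by (simp add: poly_sum poly_monom coeff_map_poly)
qed

lemma palindromic_iff_coeff:
  "palindromic n p \<longleftrightarrow> degree p \<le> n \<and> (\<forall>i\<le>n. coeff p (n - i) = coeff p i)"
proof
  assume pal: "palindromic n p"
  define m where "m = max n (degree p)"
  define l where "l = (\<Sum>i\<le>m. monom (of_int (coeff p i) :: rat) (n + m - i))"
  define s where "s = (\<Sum>i\<le>m. monom (of_int (coeff p i) :: rat) (m + i))"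
  have dm: "degree p \<le> m" "n \<le> m"
    by (auto simp: m_def)
  have eq: "poly l t = poly s t" if t: "t \<noteq> 0" for t
  proof -
    have "poly l t = (\<Sum>i\<le>m. of_int (coeff p i) * t ^ (n + m - i))"
      by (simp add: l_def poly_sum poly_monom)
    also have "\<dots> = (\<Sum>i\<le>m. t ^ m * (t ^ n * (of_int (coeff p i) * inverse t ^ i)))"
    proof (rule sum.cong)
      fix i assume "i \<in> {..m}"
      then have "t ^ (n + m - i) = t ^ (n + m) * inverse t ^ i"
        using t by (simp add: power_diff divide_inverse power_inverse)
      then show "of_int (coeff p i) * t ^ (n + m - i)
          = t ^ m * (t ^ n * (of_int (coeff p i) * inverse t ^ i))"
        by (simp only: power_add mult_ac)
    qed simp
    also have "\<dots> = t ^ m * (t ^ n * poly (map_poly of_int p) (inverse t))"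
      by (simp add: poly_of_int_sum[OF dm(1)] sum_distrib_left)
    also have "\<dots> = t ^ m * poly (map_poly of_int p) t"
      using pal t by (simp add: palindromic_def)
    also have "\<dots> = poly s t"
      by (simp add: poly_of_int_sum[OF dm(1)] sum_distrib_left s_def poly_sum poly_monom
          power_add mult.left_commute)
    finally show ?thesis .
  qed
  have "poly ([:0, 1:] * l) = poly ([:0, 1:] * s)"
  proof
    fix x show "poly ([:0, 1:] * l) x = poly ([:0, 1:] * s) x"
      using eq[of x] by (cases "x = 0") auto
  qed
  then have "[:0, 1:] * l = [:0, 1:] * s"
    by (simp only: poly_eq_poly_eq_iff)
  then have ls: "l = s"
    by simp
  have cs: "coeff s (m + k) = of_int (coeff p k)" if "k \<le> m" for k
    using that by (simp add: s_def coeff_sum sum.delta)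
  have cl: "coeff l (m + k) = (if k \<le> n then of_int (coeff p (n - k)) else 0)" for k
  proof -
    have "coeff l (m + k)
        = (\<Sum>i\<le>m. if i = n - k then (if k \<le> n then of_int (coeff p i) else 0) else 0)"
      unfolding l_def coeff_sum by (rule sum.cong) auto
    also have "\<dots> = (if k \<le> n then of_int (coeff p (n - k)) else 0)"
      using dm by (auto simp: sum.delta)
    finally show ?thesis .
  qed
  have 1: "coeff p k = (if k \<le> n then coeff p (n - k) else 0)" for k
  proof (cases "k \<le> m")
    case True
    then show ?thesis
      using cs[of k] cl[of k] ls by (auto split: if_splits)
  next
    case False
    then show ?thesis
      using dm by (simp add: coeff_eq_0)
  qed
  have "degree p \<le> n"
  proof (intro degree_le allI impI)
    fix k assume "n < k"
    then show "coeff p k = 0" by (subst 1) simp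
  qed
  moreover have "\<forall>i\<le>n. coeff p (n - i) = coeff p i"
    using 1 by metis
  ultimately show "degree p \<le> n \<and> (\<forall>i\<le>n. coeff p (n - i) = coeff p i)"
    by blast
next
  assume r: "degree p \<le> n \<and> (\<forall>i\<le>n. coeff p (n - i) = coeff p i)"
  show "palindromic n p"
    unfolding palindromic_def
  proof (intro allI impI)
    fix t :: rat assume t: "t \<noteq> 0"
    have "t ^ n * poly (map_poly of_int p) (inverse t)
        = (\<Sum>i\<le>n. of_int (coeff p i) * (t ^ n * inverse t ^ i))"
      using r by (simp add: poly_of_int_sum[of p n] sum_distrib_left mult.left_commute)
    also have "\<dots> = (\<Sum>i\<le>n. of_int (coeff p (n - i)) * t ^ (n - i))"
    proof (rule sum.cong)
      fix i assume "i \<in> {..n}"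
      then show "of_int (coeff p i) * (t ^ n * inverse t ^ i)
          = of_int (coeff p (n - i)) * t ^ (n - i)"
        using r t by (simp add: power_diff divide_inverse power_inverse)
    qed simp
    also have "\<dots> = (\<Sum>i\<le>n. of_int (coeff p i) * t ^ i)"
      by (rule sum.reindex_bij_witness[of _ "\<lambda>i. n - i" "\<lambda>i. n - i"]) auto
    also have "\<dots> = poly (map_poly of_int p) t"
      using r by (simp add: poly_of_int_sum[of p n])
    finally show "t ^ n * poly (map_poly of_int p) (inverse t) = poly (map_poly of_int p) t" .
  qed
qed

lemma palindromic_low_degree:
  assumes "palindromic n p" "2 * degree p < n"
  shows "p = 0"
proof (rule poly_eqI)
  fix i
  show "coeff p i = coeff 0 i"
  proof (cases "i \<le> degree p")
    case True
    then have "coeff p (n - i) = coeff p i" "n - i > degree p"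
      using assms by (auto simp: palindromic_iff_coeff)
    then show ?thesis
      by (simp add: coeff_eq_0)
  qed (simp add: coeff_eq_0)
qed

lemma finite_flats: "is_matroid M \<Longrightarrow> finite (flats M)"
  by (rule finite_subset[of _ "Pow (ground M)"]) (auto simp: flats_def is_matroid_def)

lemma rk_empty: "is_matroid M \<Longrightarrow> rk M {} = 0"
  unfolding is_matroid_def by (metis card.empty empty_subsetI le_zero_eq)

lemma rk_flat_le: "is_matroid M \<Longrightarrow> F \<in> flats M \<Longrightarrow> rk M F \<le> mrank M"
  by (auto simp: is_matroid_def flats_def mrank_def)

lemma empty_flat: "is_matroid M \<Longrightarrow> loopless M \<Longrightarrow> {} \<in> flats M"
  by (simp add: flats_def rk_empty loopless_def)

lemma rk_nonempty_flat:
  assumes "is_matroid M" "loopless M" "F \<in> flats M" "F \<noteq> {}"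
  shows "rk M F > 0"
proof -
  obtain x where x: "x \<in> F" using assms by auto
  have F: "F \<subseteq> ground M" using assms by (simp add: flats_def)
  have "rk M {x} \<le> rk M F"
    using assms(1) F x unfolding is_matroid_def by (meson empty_subsetI insert_subset)
  moreover have "rk M {x} \<noteq> 0"
    using assms(2) F x unfolding loopless_def by blast
  ultimately show ?thesis by linarith
qed

lemma contract_empty: "is_matroid M \<Longrightarrow> contract M {} = M"
  using rk_empty[of M] by (cases M) (simp add: contract_def)

lemma mrank_contract: "F \<in> flats M \<Longrightarrow> mrank (contract M F) = mrank M - rk M F"
  by (auto simp: mrank_def contract_def flats_def Un_absorb2)

lemma card_contract:
  assumes "is_matroid M" "F \<in> flats M" "F \<noteq> {}"
  shows "card (ground (contract M F)) < card (ground M)"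
  using assms unfolding is_matroid_def flats_def contract_def
  by (auto intro!: psubset_card_mono)

lemma is_matroid_contract:
  assumes M: "is_matroid M" and F: "F \<in> flats M"
  shows "is_matroid (contract M F)"
proof -
  have FE: "F \<subseteq> ground M" using F by (simp add: flats_def)
  have fin: "finite (ground M)"
    and ext: "\<And>X. rk M X = rk M (X \<inter> ground M)"
    and bd: "\<And>X. X \<subseteq> ground M \<Longrightarrow> rk M X \<le> card X"
    and mono: "\<And>X Y. X \<subseteq> Y \<Longrightarrow> Y \<subseteq> ground M \<Longrightarrow> rk M X \<le> rk M Y"
    and sub: "\<And>X Y. X \<subseteq> ground M \<Longrightarrow> Y \<subseteq> ground M \<Longrightarrow>
        rk M (X \<union> Y) + rk M (X \<inter> Y) \<le> rk M X + rk M Y"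
    using M by (simp_all only: is_matroid_def)
  have ext': "rk M (X \<union> F) = rk M (X \<inter> (ground M - F) \<union> F)" for X
  proof -
    have "(X \<union> F) \<inter> ground M = (X \<inter> (ground M - F) \<union> F) \<inter> ground M"
      using FE by blast
    then show ?thesis
      by (subst ext, subst (2) ext) (rule arg_cong)
  qed
  have bd': "rk M (X \<union> F) - rk M F \<le> card X" if X: "X \<subseteq> ground M - F" for X
  proof -
    have "rk M (X \<union> F) + rk M (X \<inter> F) \<le> rk M X + rk M F" "rk M X \<le> card X"
      using sub[of X F] bd[of X] X FE by auto
    then show ?thesis by linarith
  qed
  have mono': "rk M (X \<union> F) - rk M F \<le> rk M (Y \<union> F) - rk M F"
    if "X \<subseteq> Y" "Y \<subseteq> ground M - F" for X Y
  proof -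
    have "rk M (X \<union> F) \<le> rk M (Y \<union> F)"
      using that FE by (intro mono) auto
    then show ?thesis by linarith
  qed
  have sub': "(rk M ((X \<union> Y) \<union> F) - rk M F) + (rk M ((X \<inter> Y) \<union> F) - rk M F)
      \<le> (rk M (X \<union> F) - rk M F) + (rk M (Y \<union> F) - rk M F)"
    if "X \<subseteq> ground M - F" "Y \<subseteq> ground M - F" for X Y
  proof -
    have a: "rk M (X \<union> F \<union> (Y \<union> F)) + rk M ((X \<union> F) \<inter> (Y \<union> F)) \<le> rk M (X \<union> F) + rk M (Y \<union> F)"
      using that FE by (intro sub) auto
    have "X \<union> F \<union> (Y \<union> F) = X \<union> Y \<union> F" "(X \<union> F) \<inter> (Y \<union> F) = (X \<inter> Y) \<union> F"
      by auto
    with a have a: "rk M (X \<union> Y \<union> F) + rk M ((X \<inter> Y) \<union> F) \<le> rk M (X \<union> F) + rk M (Y \<union> F)"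
      by metis
    have "rk M F \<le> rk M (X \<union> F)" "rk M F \<le> rk M (Y \<union> F)"
         "rk M F \<le> rk M (X \<union> Y \<union> F)" "rk M F \<le> rk M ((X \<inter> Y) \<union> F)"
      using that FE by (auto intro!: mono)
    then show ?thesis using a by linarith
  qed
  show ?thesis
    unfolding is_matroid_def contract_def matroid.select_convs
  proof (intro conjI allI impI)
    show "finite (ground M - F)" using fin by simp
    show "rk M (X \<union> F) - rk M F = rk M (X \<inter> (ground M - F) \<union> F) - rk M F" for X
      using ext'[of X] by (rule arg_cong)
    show "rk M (X \<union> F) - rk M F \<le> card X" if "X \<subseteq> ground M - F" for X
      using that by (rule bd')
    show "rk M (X \<union> F) - rk M F \<le> rk M (Y \<union> F) - rk M F"
      if "X \<subseteq> Y \<and> Y \<subseteq> ground M - F" for X Y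
      using that mono' by blast
    show "rk M (X \<union> Y \<union> F) - rk M F + (rk M (X \<inter> Y \<union> F) - rk M F)
        \<le> rk M (X \<union> F) - rk M F + (rk M (Y \<union> F) - rk M F)"
      if "X \<subseteq> ground M - F \<and> Y \<subseteq> ground M - F" for X Y
      using that sub' by blast
  qed
qed

lemma loopless_contract:
  assumes "F \<in> flats M"
  shows "loopless (contract M F)"
  unfolding loopless_def
proof
  fix x assume "x \<in> ground (contract M F)"
  then have "rk M F < rk M ({x} \<union> F)"
    using assms by (simp add: contract_def flats_def)
  then show "rk (contract M F) {x} \<noteq> 0"
    by (simp add: contract_def)
qed

lemma Z_of_split:
  assumes "is_matroid M" "loopless M"
  shows "Z_of P M = P M + (\<Sum>F\<in>flats M - {{}}. monom 1 (rk M F) * P (contract M F))"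
  unfolding Z_of_def
  using assms
  by (simp add: sum.remove[OF finite_flats empty_flat] rk_empty contract_empty monom_0 one_pCons[symmetric])

lemma KL_family_unique:
  assumes P: "KL_family P" and Q: "KL_family Q"
  shows "is_matroid M \<Longrightarrow> loopless M \<Longrightarrow> P M = Q M"
proof (induction "card (ground M)" arbitrary: M rule: less_induct)
  case less
  show ?case
  proof (cases "mrank M = 0")
    case True
    then show ?thesis using P Q less.prems by (simp add: KL_family_def)
  next
    case False
    have "P (contract M F) = Q (contract M F)" if "F \<in> flats M - {{}}" for F
      using that less by (intro less.hyps) (auto simp: card_contract is_matroid_contract loopless_contract)
    then have "P M - Q M = Z_of P M - Z_of Q M"
      by (simp add: Z_of_split[OF less.prems])
    moreover have "palindromic (mrank M) (Z_of P M)" "palindromic (mrank M) (Z_of Q M)"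
      using P Q less.prems by (auto simp: KL_family_def)
    ultimately have "palindromic (mrank M) (P M - Q M)"
      by (auto simp: palindromic_iff_coeff intro: degree_diff_le)
    moreover have "2 * degree (P M) < mrank M" "2 * degree (Q M) < mrank M"
      using P Q less.prems False by (auto simp: KL_family_def dest!: spec[of _ M])
    then have "2 * degree (P M - Q M) < mrank M"
      using degree_diff_le_max[of "P M" "Q M"] by linarith
    ultimately show ?thesis
      using palindromic_low_degree by fastforce
  qed
qed

text \<open>
  Existence: the coefficients of \<open>P\<^sub>M\<close> below degree \<open>rk M / 2\<close> are forced by the palindromicity of
  \<open>Z\<^sub>M\<close> and the polynomials of the proper contractions.
\<close>

function KL_rec :: "'a matroid \<Rightarrow> int poly" where
  "KL_rec M =
    (if is_matroid M \<and> loopless M then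
       (if mrank M = 0 then 1
        else (let S = (\<Sum>F\<in>flats M - {{}}. monom 1 (rk M F) * KL_rec (contract M F))
              in \<Sum>i | 2 * i < mrank M. monom (coeff S (mrank M - i) - coeff S i) i))
     else 0)"
  by auto
termination
  by (relation "measure (\<lambda>M. card (ground M))") (auto simp: card_contract)

declare KL_rec.simps [simp del]

lemma KL_rec_props:
  assumes "is_matroid M" "loopless M"
  shows "(mrank M = 0 \<longrightarrow> KL_rec M = 1) \<and>
         (mrank M > 0 \<longrightarrow> 2 * degree (KL_rec M) < mrank M) \<and>
         palindromic (mrank M) (Z_of KL_rec M)"
  using assms
proof (induction "card (ground M)" arbitrary: M rule: less_induct)
  case less
  note M = less.prems
  define n where "n = mrank M"
  define S where "S = (\<Sum>F\<in>flats M - {{}}. monom 1 (rk M F) * KL_rec (contract M F))"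
  show ?case
  proof (cases "n = 0")
    case True
    then have "flats M - {{}} = {}"
      using rk_nonempty_flat[OF M] rk_flat_le[OF M(1)] unfolding n_def by fastforce
    then have "Z_of KL_rec M = KL_rec M"
      by (simp only: Z_of_split[OF M] sum.empty add_0_right)
    moreover have "KL_rec M = 1"
      using True M by (subst KL_rec.simps) (simp add: n_def)
    ultimately show ?thesis
      using True by (simp add: n_def palindromic_iff_coeff)
  next
    case False
    have Krec: "KL_rec M = (\<Sum>i | 2 * i < n. monom (coeff S (n - i) - coeff S i) i)"
      using False M by (subst KL_rec.simps) (simp add: n_def S_def Let_def)
    have fin: "finite {i. 2 * i < n}"
      by (rule finite_subset[of _ "{..n}"]) auto
    have cK: "coeff (KL_rec M) k = (if 2 * k < n then coeff S (n - k) - coeff S k else 0)" for k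
      unfolding Krec coeff_sum using fin by (simp add: sum.delta)
    have "degree S \<le> n"
      unfolding S_def
    proof (rule degree_sum_le)
      show "finite (flats M - {{}})" using finite_flats[OF M(1)] by simp
    next
      fix F assume F: "F \<in> flats M - {{}}"
      let ?N = "contract M F"
      have "(mrank ?N = 0 \<longrightarrow> KL_rec ?N = 1) \<and> (mrank ?N > 0 \<longrightarrow> 2 * degree (KL_rec ?N) < mrank ?N)"
        using less.hyps[of ?N] F M by (simp add: card_contract is_matroid_contract loopless_contract)
      then have "degree (KL_rec ?N) \<le> mrank ?N"
        by (cases "mrank ?N = 0") auto
      then have "rk M F + degree (KL_rec ?N) \<le> n"
        using F rk_flat_le[OF M(1), of F] by (simp add: mrank_contract n_def)
      moreover have "degree (monom (1::int) (rk M F)) = rk M F"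
        by (simp add: degree_monom_eq)
      ultimately show "degree (monom 1 (rk M F) * KL_rec ?N) \<le> n"
        using degree_mult_le[of "monom 1 (rk M F)" "KL_rec ?N"] by linarith
    qed
    have dK: "2 * degree (KL_rec M) < n"
    proof (cases "degree (KL_rec M) = 0")
      case False
      then have "coeff (KL_rec M) (degree (KL_rec M)) \<noteq> 0"
        by auto
      then show ?thesis using cK by metis
    qed (use False in simp)
    have "palindromic n (KL_rec M + S)"
      unfolding palindromic_iff_coeff
    proof (intro conjI allI impI)
      show "degree (KL_rec M + S) \<le> n"
        using dK \<open>degree S \<le> n\<close> by (intro degree_add_le) auto
    next
      fix i assume i: "i \<le> n"
      consider "2 * i < n" | "2 * i = n" | "2 * i > n" by linarith
      then show "coeff (KL_rec M + S) (n - i) = coeff (KL_rec M + S) i"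
      proof cases
        case 2
        then have "n - i = i" by linarith
        then show ?thesis by simp
      qed (use i in \<open>auto simp: cK\<close>)
    qed
    moreover have "Z_of KL_rec M = KL_rec M + S"
      by (simp add: Z_of_split[OF M] S_def)
    ultimately show ?thesis
      using False dK by (simp add: n_def)
  qed
qed

theorem KL_family_unique_existence:
  "\<exists>!P. KL_family P \<and> (\<forall>M. \<not> (is_matroid M \<and> loopless M) \<longrightarrow> P M = 0)"
proof (rule ex_ex1I)
  have "KL_family KL_rec"
    using KL_rec_props unfolding KL_family_def by fastforce
  moreover have "\<forall>M. \<not> (is_matroid M \<and> loopless M) \<longrightarrow> KL_rec M = 0"
    by (auto simp: KL_rec.simps)
  ultimately show "\<exists>P. KL_family P \<and> (\<forall>M. \<not> (is_matroid M \<and> loopless M) \<longrightarrow> P M = 0)"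
    by blast
next
  fix P Q :: "'a matroid \<Rightarrow> int poly"
  assume "KL_family P \<and> (\<forall>M. \<not> (is_matroid M \<and> loopless M) \<longrightarrow> P M = 0)"
    and "KL_family Q \<and> (\<forall>M. \<not> (is_matroid M \<and> loopless M) \<longrightarrow> Q M = 0)"
  then show "P = Q"
    using KL_family_unique by (metis (no_types, lifting) ext)
qed

lemma KL_family_KL_poly: "KL_family KL_poly"
  using theI'[OF KL_family_unique_existence] unfolding KL_poly_def by blast

section \<open>Projective geometry over a finite field\<close>

text \<open>
  Vectors are sequences \<open>nat \<Rightarrow> 'k\<close>, and \<open>'k\<^sup>r\<close> is the subspace of those supported on
  \<open>{0..<r}\<close>. This keeps \<open>r \<ge> 0\<close> an ordinary variable. The ambient space \<open>nat \<Rightarrow> 'k\<close> is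
  infinite-dimensional, but only subspaces of some \<open>coord_space r\<close> are used.
\<close>

definition vscale :: "'k::field \<Rightarrow> (nat \<Rightarrow> 'k) \<Rightarrow> (nat \<Rightarrow> 'k)" where
  "vscale c v = (\<lambda>i. c * v i)"

interpretation vs: vector_space "vscale :: 'k::field \<Rightarrow> (nat \<Rightarrow> 'k) \<Rightarrow> (nat \<Rightarrow> 'k)"
  by unfold_locales (auto simp: vscale_def algebra_simps)

definition coord_space :: "nat \<Rightarrow> (nat \<Rightarrow> 'k::field) set" where
  "coord_space r = {v. \<forall>i\<ge>r. v i = 0}"

text \<open>A projective point is the one-dimensional subspace itself, as a set of vectors.\<close>

definition proj :: "(nat \<Rightarrow> 'k::field) set \<Rightarrow> (nat \<Rightarrow> 'k) set set" where
  "proj A = {L. vs.subspace L \<and> L \<subseteq> A \<and> vs.dim L = 1}"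

definition point_span :: "(nat \<Rightarrow> 'k::field) set set \<Rightarrow> (nat \<Rightarrow> 'k) set" where
  "point_span S = vs.span (\<Union>S)"

definition represented_matroid :: "(nat \<Rightarrow> 'k::field) set set \<Rightarrow> (nat \<Rightarrow> 'k) set matroid" where
  "represented_matroid E = \<lparr>ground = E, rk = (\<lambda>S. vs.dim (point_span (S \<inter> E)))\<rparr>"

definition flat_span :: "(nat \<Rightarrow> 'k::field) set \<Rightarrow> (nat \<Rightarrow> 'k) set set \<Rightarrow> (nat \<Rightarrow> 'k) set \<Rightarrow> bool" where
  "flat_span V E U \<longleftrightarrow> vs.subspace U \<and> U \<subseteq> V \<and> point_span (E \<inter> proj U) = U"

definition subspace_poly ::
  "(nat \<Rightarrow> 'k::field) set \<Rightarrow> (nat \<Rightarrow> 'k) set set \<Rightarrow> (nat \<Rightarrow> 'k) set \<Rightarrow> int poly" where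
  "subspace_poly V D U =
     (\<Sum>A | vs.subspace A \<and> U \<subseteq> A \<and> A \<subseteq> V \<and> proj A - proj U \<subseteq> D.
        monom 1 (vs.dim A - vs.dim U))"

definition gauss_binomial :: "nat \<Rightarrow> nat \<Rightarrow> nat \<Rightarrow> rat" where
  "gauss_binomial q m j = (\<Prod>i<j. (of_nat q ^ (m - i) - 1) / (of_nat q ^ (j - i) - 1))"

end

theory Submission
  imports Defs "HOL-Library.FuncSet"
begin

text \<open>
  Grouping the subspaces \<open>A\<close> between a flat span \<open>U\<close> and \<open>V\<close> by the span of the points of \<open>E\<close> in
  \<open>A\<close> gives \<open>\<Sum>\<^sub>W t\<^bsup>dim W - dim U\<^esup> C\<^sub>W = \<Sum>\<^sub>A t\<^bsup>dim A - dim U\<^esup>\<close>, the sum on the left being over the flat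
  spans \<open>W \<supseteq> U\<close>. The right-hand side is palindromic because Gaussian binomials are symmetric. So
  the \<open>C\<^sub>U\<close> satisfy the recursion that characterizes the Kazhdan--Lusztig polynomials of the
  contractions, and the right-hand side at \<open>U = 0\<close> is the \<open>Z\<close>-polynomial.
\<close>

section \<open>Finite subspaces\<close>

lemma card_field_ge_2: "CARD('k::{field,finite}) \<ge> 2"
proof -
  have "card {0, 1::'k} \<le> CARD('k)"
    by (rule card_mono) auto
  then show ?thesis by simp
qed

text \<open>Every vector of the larger span is \<open>vscale c x + v\<close> for exactly one scalar
  \<open>c\<close> and one \<open>v\<close> in \<open>vs.span S\<close>: two different scalars would
  put a nonzero multiple of \<open>x\<close>, and so \<open>x\<close>, into
  \<open>vs.span S\<close>.\<close>

lemma card_span_insert: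
  fixes S :: "(nat \<Rightarrow> 'k::{field,finite}) set"
  assumes "x \<notin> vs.span S"
  shows "card (vs.span (insert x S)) = CARD('k) * card (vs.span S)"
proof -
  let ?f = "\<lambda>(c, v). vscale c x + v"
  have "bij_betw ?f (UNIV \<times> vs.span S) (vs.span (insert x S))"
    unfolding bij_betw_def
  proof
    show "inj_on ?f (UNIV \<times> vs.span S)"
    proof (rule inj_onI, clarsimp)
      fix c d v w
      assume v: "v \<in> vs.span S" "w \<in> vs.span S" and eq: "vscale c x + v = vscale d x + w"
      have d: "vscale (c - d) x = w - v"
        using eq by (simp add: vs.scale_left_diff_distrib algebra_simps)
      have "c = d"
      proof (rule ccontr)
        assume "c \<noteq> d"
        then have "x = vscale (inverse (c - d)) (vscale (c - d) x)"
          by simp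
        also have "\<dots> \<in> vs.span S"
          unfolding d by (intro vs.span_scale vs.span_diff v)
        finally show False using assms by simp
      qed
      then show "c = d \<and> v = w"
        using eq by simp
    qed
    show "?f ` (UNIV \<times> vs.span S) = vs.span (insert x S)"
    proof (intro equalityI subsetI)
      fix y assume "y \<in> vs.span (insert x S)"
      then obtain c where "y - vscale c x \<in> vs.span S"
        by (auto simp: vs.span_breakdown_eq)
      then show "y \<in> ?f ` (UNIV \<times> vs.span S)"
        by (intro image_eqI[where x = "(c, y - vscale c x)"]) auto
    next
      fix y assume "y \<in> ?f ` (UNIV \<times> vs.span S)"
      then obtain c v where "y = vscale c x + v" "v \<in> vs.span S"
        by auto
      then show "y \<in> vs.span (insert x S)"
        unfolding vs.span_breakdown_eq by (intro exI[of _ c]) simp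
    qed
  qed
  then show ?thesis
    by (metis bij_betw_same_card card_cartesian_product)
qed

text \<open>The ambient space \<open>nat \<Rightarrow> 'k\<close> is infinite-dimensional, so
  dimensions of finite subspaces are compared through cardinalities: as
  \<open>CARD('k) \<ge> 2\<close>, the cardinality determines the exponent.\<close>

lemma card_subspace:
  fixes A :: "(nat \<Rightarrow> 'k::{field,finite}) set"
  assumes "vs.subspace A" "finite A"
  shows "card A = CARD('k) ^ vs.dim A"
proof -
  have *: "card (vs.span B) = CARD('k) ^ card B"
    if "finite B" "vs.independent B" for B :: "(nat \<Rightarrow> 'k) set"
    using that
  proof (induction B rule: finite_induct)
    case (insert x B)
    then show ?case
      by (auto simp: vs.independent_insert card_span_insert)
  qed simp
  obtain B where B: "B \<subseteq> A" "vs.independent B" "A \<subseteq> vs.span B" "card B = vs.dim A"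
    using vs.basis_exists by blast
  then have "vs.span B = A"
    using vs.span_minimal[of B A] assms by blast
  then show ?thesis
    using * B assms finite_subset by metis
qed

lemma dim_mono:
  fixes A B :: "(nat \<Rightarrow> 'k::{field,finite}) set"
  assumes "vs.subspace A" "vs.subspace B" "finite B" "A \<subseteq> B"
  shows "vs.dim A \<le> vs.dim B"
proof -
  have "CARD('k) ^ vs.dim A \<le> CARD('k) ^ vs.dim B"
    using assms card_mono[of B A] card_subspace[of A] card_subspace[of B]
    by (simp add: finite_subset)
  then show ?thesis
    using card_field_ge_2[where 'k = 'k] by (simp add: power_increasing_iff)
qed

lemma subspace_dim_eq:
  fixes A B :: "(nat \<Rightarrow> 'k::{field,finite}) set"
  assumes "vs.subspace A" "vs.subspace B" "finite B" "A \<subseteq> B" "vs.dim A = vs.dim B"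
  shows "A = B"
  using assms card_subspace[of A] card_subspace[of B] finite_subset[of A B]
  by (intro card_subset_eq) auto

lemma dim_span_insert:
  fixes S :: "(nat \<Rightarrow> 'k::{field,finite}) set"
  assumes "x \<notin> vs.span S" "finite (vs.span (insert x S))"
  shows "vs.dim (insert x S) = Suc (vs.dim S)"
proof -
  have f: "finite (vs.span S)"
    using assms(2) by (rule rev_finite_subset) (rule vs.span_mono, auto)
  have "CARD('k) ^ vs.dim (insert x S) = CARD('k) ^ Suc (vs.dim S)"
    using card_span_insert[OF assms(1)] card_subspace[OF vs.subspace_span f]
      card_subspace[OF vs.subspace_span assms(2)] by simp
  then show ?thesis
    using card_field_ge_2[where 'k = 'k] power_inject_exp[of "CARD('k)"]
    by (metis Suc_1 Suc_le_lessD)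
qed

text \<open>An injection of \<open>S \<times> (A \<inter> B)\<close> into
  \<open>A \<times> B\<close>, where \<open>S\<close> is the sum of \<open>A\<close> and
  \<open>B\<close>, gives the inequality after taking logarithms to base \<open>CARD('k)\<close>. It
  is the source of submodularity for represented matroids.\<close>

lemma dim_Un_Int:
  fixes A B :: "(nat \<Rightarrow> 'k::{field,finite}) set"
  assumes A: "vs.subspace A" "finite A" and B: "vs.subspace B" "finite B"
  shows "vs.dim (A \<union> B) + vs.dim (A \<inter> B) \<le> vs.dim A + vs.dim B"
proof -
  define S where "S = {x + y |x y. x \<in> A \<and> y \<in> B}"
  have S: "vs.span (A \<union> B) = S"
    using A B by (simp add: S_def vs.span_Un vs.span_eq_iff[THEN iffD2])
  have "S = (\<lambda>(x, y). x + y) ` (A \<times> B)"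
    by (auto simp: S_def)
  then have fS: "finite S"
    using A B by simp
  \<comment> \<open>An arbitrary splitting \<open>s = a s + b s\<close> is fixed for each
    \<open>s\<close> in the sum; \<open>d\<close> in \<open>A \<inter> B\<close> then moves between
    the two parts. Adding the components of \<open>?f (s, d)\<close> recovers \<open>s\<close>,
    after which the first one gives \<open>d\<close>.\<close>
  define a where "a s = (SOME x. x \<in> A \<and> s - x \<in> B)" for s
  define b where "b s = s - a s" for s
  have ab: "a s \<in> A \<and> b s \<in> B \<and> s = a s + b s" if s: "s \<in> S" for s
  proof -
    have "\<exists>x. x \<in> A \<and> s - x \<in> B"
      using s unfolding S_def by force
    then have "a s \<in> A \<and> s - a s \<in> B"
      unfolding a_def by (rule someI_ex)
    then show ?thesis
      by (simp add: b_def)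
  qed
  let ?f = "\<lambda>(s, d). (a s + d, b s - d)"
  have "inj_on ?f (S \<times> (A \<inter> B))"
  proof (rule inj_onI, clarify)
    fix s d s' d'
    assume s: "s \<in> S" "s' \<in> S" and e: "a s + d = a s' + d'" "b s - d = b s' - d'"
    have "a s + d + (b s - d) = a s' + d' + (b s' - d')"
      unfolding e ..
    then have "s = s'"
      using ab[OF s(1)] ab[OF s(2)] by (simp add: algebra_simps)
    then show "s = s' \<and> d = d'"
      using e by simp
  qed
  moreover have "?f ` (S \<times> (A \<inter> B)) \<subseteq> A \<times> B"
    using ab A B by (auto intro!: vs.subspace_add vs.subspace_diff)
  ultimately have "card (S \<times> (A \<inter> B)) \<le> card (A \<times> B)"
    using A B by (intro card_inj_on_le[of ?f]) auto
  moreover have "card S = CARD('k) ^ vs.dim (A \<union> B)"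
    using card_subspace[of S] fS S by (metis vs.dim_span vs.subspace_span)
  moreover have "card (A \<inter> B) = CARD('k) ^ vs.dim (A \<inter> B)"
    using A B by (intro card_subspace vs.subspace_inter) auto
  ultimately have "CARD('k) ^ (vs.dim (A \<union> B) + vs.dim (A \<inter> B)) \<le> CARD('k) ^ (vs.dim A + vs.dim B)"
    using A B by (simp add: card_cartesian_product card_subspace power_add)
  then show ?thesis
    using card_field_ge_2[where 'k = 'k] by (simp add: power_increasing_iff)
qed

lemma card_coord_space: "card (coord_space r :: (nat \<Rightarrow> 'k::{field,finite}) set) = CARD('k) ^ r"
proof -
  have "bij_betw (\<lambda>f i. if i < r then f i else 0) ({..<r} \<rightarrow>\<^sub>E UNIV)
      (coord_space r :: (nat \<Rightarrow> 'k) set)"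
    by (rule bij_betw_byWitness[where f' = "\<lambda>f. restrict f {..<r}"])
      (auto simp: coord_space_def restrict_def PiE_def extensional_def fun_eq_iff)
  then show ?thesis
    by (simp add: bij_betw_same_card[symmetric] card_PiE)
qed

lemma subspace_coord_space: "vs.subspace (coord_space r)"
  by (auto simp: vs.subspace_def coord_space_def vscale_def)

lemma finite_coord_space: "finite (coord_space r :: (nat \<Rightarrow> 'k::{field,finite}) set)"
  using card_coord_space[of r, where 'k = 'k] card_field_ge_2[where 'k = 'k]
  by (intro card_ge_0_finite) simp

lemma dim_coord_space: "vs.dim (coord_space r :: (nat \<Rightarrow> 'k::{field,finite}) set) = r"
proof -
  have "CARD('k) ^ vs.dim (coord_space r :: (nat \<Rightarrow> 'k) set) = CARD('k) ^ r"
    using card_subspace[of "coord_space r :: (nat \<Rightarrow> 'k) set"]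
    by (simp add: subspace_coord_space finite_coord_space card_coord_space)
  then show ?thesis
    using card_field_ge_2[where 'k = 'k] power_inject_exp[of "CARD('k)"]
    by (metis Suc_1 Suc_le_lessD)
qed

section \<open>Counting the subspaces in an interval\<close>

text \<open>Linear independence modulo \<open>U\<close>, tested from the tail: each entry avoids the
  span of \<open>U\<close> and the later entries, so a list is extended at its head.\<close>

fun indep_over :: "(nat \<Rightarrow> 'k::field) set \<Rightarrow> (nat \<Rightarrow> 'k) list \<Rightarrow> bool" where
  "indep_over U [] \<longleftrightarrow> True"
| "indep_over U (x # xs) \<longleftrightarrow> x \<notin> vs.span (U \<union> set xs) \<and> indep_over U xs"

lemma dim_indep_over:
  fixes U V :: "(nat \<Rightarrow> 'k::{field,finite}) set"
  assumes "vs.subspace V" "finite V" "U \<subseteq> V" "set xs \<subseteq> V" "indep_over U xs"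
  shows "vs.dim (U \<union> set xs) = vs.dim U + length xs"
  using assms(4,5)
proof (induction xs)
  case (Cons x xs)
  have "vs.span (insert x (U \<union> set xs)) \<subseteq> V"
    using assms Cons.prems by (intro vs.span_minimal) auto
  then show ?case
    using Cons dim_span_insert[of x "U \<union> set xs"] assms(2) by (auto dest: finite_subset)
qed simp

text \<open>After \<open>k\<close> choices, \<open>U\<close> and the chosen vectors span
  \<open>CARD('k) ^ (vs.dim U + k)\<close> vectors, which are exactly those forbidden for the next
  head. For \<open>k\<close> beyond the codimension of \<open>U\<close> the factor at
  \<open>i = vs.dim V - vs.dim U\<close> is zero, in line with there being no such list.\<close>

lemma card_indep_over:
  fixes U V :: "(nat \<Rightarrow> 'k::{field,finite}) set"
  assumes V: "vs.subspace V" "finite V" and U: "U \<subseteq> V"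
  shows "card {xs. length xs = k \<and> set xs \<subseteq> V \<and> indep_over U xs}
      = (\<Prod>i<k. CARD('k) ^ vs.dim V - CARD('k) ^ (vs.dim U + i))"
proof (induction k)
  case 0
  have "{xs. length xs = 0 \<and> set xs \<subseteq> V \<and> indep_over U xs} = {[]}"
    by auto
  then show ?case by simp
next
  case (Suc k)
  let ?T = "\<lambda>k. {xs. length xs = k \<and> set xs \<subseteq> V \<and> indep_over U xs}"
  have fin: "finite (?T k)"
    by (rule finite_subset[OF _ finite_lists_length_eq[OF V(2), of k]]) auto
  have "?T (Suc k) = (\<lambda>(xs, x). x # xs) ` (SIGMA xs : ?T k. V - vs.span (U \<union> set xs))"
    by (auto simp: length_Suc_conv image_iff)
  moreover have "inj_on (\<lambda>(xs, x). x # xs) (SIGMA xs : ?T k. V - vs.span (U \<union> set xs))"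
    by (auto simp: inj_on_def)
  ultimately have "card (?T (Suc k)) = (\<Sum>xs\<in>?T k. card (V - vs.span (U \<union> set xs)))"
    using fin V by (simp add: card_image)
  also have "\<dots> = (\<Sum>xs\<in>?T k. CARD('k) ^ vs.dim V - CARD('k) ^ (vs.dim U + k))"
  proof (rule sum.cong)
    fix xs assume xs: "xs \<in> ?T k"
    have sub: "vs.span (U \<union> set xs) \<subseteq> V"
      using U xs V by (intro vs.span_minimal) auto
    then have f: "finite (vs.span (U \<union> set xs))"
      using V finite_subset by blast
    then have "card (vs.span (U \<union> set xs)) = CARD('k) ^ (vs.dim U + k)"
      using card_subspace[OF vs.subspace_span f] dim_indep_over[OF V U, of xs] xs by simp
    then show "card (V - vs.span (U \<union> set xs)) = CARD('k) ^ vs.dim V - CARD('k) ^ (vs.dim U + k)"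
      using sub f card_subspace[OF V] by (simp add: card_Diff_subset)
  qed simp
  finally show ?case
    using Suc by (simp add: mult.commute)
qed

definition subspaces_between ::
  "(nat \<Rightarrow> 'k::field) set \<Rightarrow> (nat \<Rightarrow> 'k) set \<Rightarrow> (nat \<Rightarrow> 'k) set set" where
  "subspaces_between U V = {A. vs.subspace A \<and> U \<subseteq> A \<and> A \<subseteq> V}"

lemma finite_subspaces_between: "finite V \<Longrightarrow> finite (subspaces_between U V)"
  by (rule finite_subset[of _ "Pow V"]) (auto simp: subspaces_between_def)

text \<open>Both sides count the tuples of \<open>k\<close> vectors of \<open>V\<close> independent modulo \<open>U\<close>, the left one
  according to the subspace that they generate together with \<open>U\<close>.\<close>

lemma card_subspaces_between_mult:
  fixes U V :: "(nat \<Rightarrow> 'k::{field,finite}) set"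
  assumes V: "vs.subspace V" "finite V" and U: "vs.subspace U" "U \<subseteq> V"
  shows "card {A \<in> subspaces_between U V. vs.dim A = vs.dim U + k}
        * (\<Prod>i<k. CARD('k) ^ (vs.dim U + k) - CARD('k) ^ (vs.dim U + i))
      = (\<Prod>i<k. CARD('k) ^ vs.dim V - CARD('k) ^ (vs.dim U + i))"
proof -
  let ?G = "{A \<in> subspaces_between U V. vs.dim A = vs.dim U + k}"
  let ?T = "\<lambda>A. {xs. length xs = k \<and> set xs \<subseteq> A \<and> indep_over U xs}"
  have finG: "finite ?G"
    using finite_subspaces_between[OF V(2)] by simp
  have A: "vs.subspace A" "finite A" "U \<subseteq> A" "A \<subseteq> V" "vs.dim A = vs.dim U + k" if "A \<in> ?G" for A
    using that V finite_subset by (auto simp: subspaces_between_def)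
  \<comment> \<open>A tuple determines its subspace, since what it generates over \<open>U\<close>
    lies in \<open>A\<close> and already has the dimension of \<open>A\<close>. Hence the classes
    \<open>?T A\<close> are disjoint.\<close>
  have span: "vs.span (U \<union> set xs) = A" if "A \<in> ?G" "xs \<in> ?T A" for A xs
  proof (rule subspace_dim_eq)
    show "vs.span (U \<union> set xs) \<subseteq> A"
      using that A[of A] by (intro vs.span_minimal) auto
    show "vs.dim (vs.span (U \<union> set xs)) = vs.dim A"
      using that A[of A] dim_indep_over[of A U xs] by simp
  qed (use that A[of A] in auto)
  have "?T V = (\<Union>A\<in>?G. ?T A)"
  proof (intro equalityI subsetI)
    fix xs assume xs: "xs \<in> ?T V"
    have "U \<union> set xs \<subseteq> vs.span (U \<union> set xs)"
      by (rule vs.span_superset)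
    moreover have "vs.span (U \<union> set xs) \<subseteq> V"
      using xs U V by (intro vs.span_minimal) auto
    ultimately have "vs.span (U \<union> set xs) \<in> ?G"
      using xs U V dim_indep_over[of V U xs] by (simp add: subspaces_between_def)
    moreover have "xs \<in> ?T (vs.span (U \<union> set xs))"
      using xs by (auto intro: vs.span_base)
    ultimately show "xs \<in> (\<Union>A\<in>?G. ?T A)"
      by blast
  qed (auto simp: subspaces_between_def)
  then have "card (?T V) = (\<Sum>A\<in>?G. card (?T A))"
  proof (simp only:, intro card_UN_disjoint finG)
    show "\<forall>A\<in>?G. finite (?T A)"
      using A(2) finite_lists_length_eq[of _ k] by (auto intro: rev_finite_subset)
    show "\<forall>A\<in>?G. \<forall>B\<in>?G. A \<noteq> B \<longrightarrow> ?T A \<inter> ?T B = {}"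
      using span by blast
  qed
  also have "\<dots> = (\<Sum>A\<in>?G. \<Prod>i<k. CARD('k) ^ (vs.dim U + k) - CARD('k) ^ (vs.dim U + i))"
  proof (rule sum.cong)
    fix A assume G: "A \<in> ?G"
    show "card (?T A) = (\<Prod>i<k. CARD('k) ^ (vs.dim U + k) - CARD('k) ^ (vs.dim U + i))"
      using card_indep_over[of A U k] A[OF G] by simp
  qed simp
  finally show ?thesis
    using card_indep_over[OF V U(2), of k] by simp
qed

text \<open>In the double count each factor is a power \<open>q ^ (d + i)\<close> times
  \<open>q ^ (m - i) - 1\<close>. The powers are the same on both sides and cancel, leaving the
  Gaussian quotient. The bound on \<open>k\<close> keeps the natural-number subtractions
  exact.\<close>

lemma card_subspaces_between:
  fixes U V :: "(nat \<Rightarrow> 'k::{field,finite}) set"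
  assumes V: "vs.subspace V" "finite V" and U: "vs.subspace U" "U \<subseteq> V"
    and k: "k \<le> vs.dim V - vs.dim U"
  shows "of_nat (card {A \<in> subspaces_between U V. vs.dim A = vs.dim U + k})
      = gauss_binomial CARD('k) (vs.dim V - vs.dim U) k"
proof -
  define n where "n = vs.dim V - vs.dim U"
  define d where "d = vs.dim U"
  define q :: rat where "q = of_nat CARD('k)"
  define N where "N = card {A \<in> subspaces_between U V. vs.dim A = vs.dim U + k}"
  have dV: "vs.dim V = d + n"
    using dim_mono[OF U(1) V U(2)] by (simp add: n_def d_def)
  have q: "q > 1"
    using card_field_ge_2[where 'k = 'k] by (simp add: q_def)
  have kn: "k \<le> n"
    using k by (simp add: n_def)
  have q1: "q ^ m \<noteq> 1" if "m > 0" for m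
    using one_less_power[OF q that] by simp
  have diff: "(of_nat (CARD('k) ^ (d + m) - CARD('k) ^ (d + i)) :: rat) = q ^ (d + i) * (q ^ (m - i) - 1)"
    if "i \<le> m" for m i
    using that by (simp add: q_def of_nat_diff power_increasing right_diff_distrib flip: power_add)
  have "rat_of_nat N * (\<Prod>i<k. q ^ (d + i) * (q ^ (k - i) - 1)) = (\<Prod>i<k. q ^ (d + i) * (q ^ (n - i) - 1))"
    using arg_cong[OF card_subspaces_between_mult[OF V U, of k], of rat_of_nat] kn
    unfolding dV d_def[symmetric] N_def[folded d_def, symmetric]
    by (simp add: diff del: of_nat_diff)
  moreover have "(\<Prod>i<k. q ^ (d + i)) \<noteq> 0" "(\<Prod>i<k. q ^ (k - i) - 1) \<noteq> 0"
    using q q1 by auto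
  ultimately have "rat_of_nat N = (\<Prod>i<k. q ^ (n - i) - 1) / (\<Prod>i<k. q ^ (k - i) - 1)"
    unfolding prod.distrib by (simp add: nonzero_eq_divide_eq mult.left_commute)
  then show ?thesis
    by (simp add: gauss_binomial_def prod_dividef N_def n_def q_def d_def)
qed

section \<open>Symmetry of Gaussian binomials and the rank polynomial of an interval\<close>

lemma gauss_binomial_symmetric:
  assumes "k \<le> n" "q \<ge> 2"
  shows "gauss_binomial q n (n - k) = gauss_binomial q n k"
proof -
  \<comment> \<open>\<open>f m\<close> is the q-factorial of \<open>m\<close> without its
    denominator \<open>(q - 1) ^ m\<close>; the binomial becomes
    \<open>f n / (f k * f (n - k))\<close>, which is visibly symmetric.\<close>
  define f :: "nat \<Rightarrow> rat" where "f m = (\<Prod>i<m. of_nat q ^ Suc i - 1)" for m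
  have f0: "f m \<noteq> 0" for m
  proof -
    have "(of_nat q :: rat) ^ Suc i > 1" for i
      using assms(2) by (intro one_less_power) auto
    then show ?thesis
      unfolding f_def by (auto simp: less_le simp del: power_Suc)
  qed
  \<comment> \<open>The factors on the left are those of \<open>f m\<close> that are missing from
    \<open>f (m - k)\<close>. With \<open>m = n\<close> this treats the numerator of the binomial,
    with \<open>m = k\<close> its denominator.\<close>
  have down: "(\<Prod>i<k. (of_nat q ^ (m - i) - 1 :: rat)) * f (m - k) = f m" if "k \<le> m" for k m
    using that
  proof (induction k)
    case (Suc k)
    then have "f (m - k) = (of_nat q ^ (m - k) - 1) * f (m - Suc k)"
      by (simp add: f_def Suc_diff_Suc[symmetric] mult.commute del: power_Suc)
    then show ?case
      using Suc by (simp add: mult.assoc)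
  qed simp
  have "gauss_binomial q n k = f n / (f k * f (n - k))" if "k \<le> n" for k
  proof -
    have "(\<Prod>i<k. (of_nat q ^ (k - i) - 1 :: rat)) = f k"
      using down[of k k] by (simp add: f_def)
    then show ?thesis
      using down[OF that] f0[of k] f0[of "n - k"]
      by (simp add: gauss_binomial_def prod_dividef field_simps)
  qed
  then show ?thesis
    using assms(1) by (simp add: mult.commute)
qed

text \<open>The rank generating function of the lattice of subspaces of the quotient
  \<open>V/U\<close>.\<close>

definition interval_poly :: "(nat \<Rightarrow> 'k::field) set \<Rightarrow> (nat \<Rightarrow> 'k) set \<Rightarrow> int poly" where
  "interval_poly U V = (\<Sum>A\<in>subspaces_between U V. monom 1 (vs.dim A - vs.dim U))"

lemma map_poly_interval_poly:
  fixes U V :: "(nat \<Rightarrow> 'k::{field,finite}) set"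
  assumes V: "vs.subspace V" "finite V" and U: "vs.subspace U" "U \<subseteq> V"
  shows "map_poly rat_of_int (interval_poly U V) =
    (\<Sum>j\<le>vs.dim V - vs.dim U. monom (gauss_binomial CARD('k) (vs.dim V - vs.dim U) j) j)"
proof (rule poly_eqI)
  fix j
  have fin: "finite (subspaces_between U V)"
    by (rule finite_subspaces_between[OF V(2)])
  have dim: "vs.dim U \<le> vs.dim A" "vs.dim A \<le> vs.dim V" if "A \<in> subspaces_between U V" for A
    using that V U dim_mono[of U A] dim_mono[of A V] finite_subset[of A V]
    by (auto simp: subspaces_between_def)
  \<comment> \<open>Because \<open>vs.dim U \<le> vs.dim A\<close>, the truncated exponent equals
    \<open>j\<close> only when \<open>vs.dim A = vs.dim U + j\<close>; this matters at
    \<open>j = 0\<close>.\<close>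
  have "coeff (interval_poly U V) j = (\<Sum>A\<in>subspaces_between U V. if vs.dim A = vs.dim U + j then 1 else 0)"
    unfolding interval_poly_def coeff_sum using dim by (intro sum.cong) auto
  then have c: "coeff (interval_poly U V) j = int (card {A \<in> subspaces_between U V. vs.dim A = vs.dim U + j})"
    using fin by (simp add: sum.If_cases Int_def)
  show "coeff (map_poly rat_of_int (interval_poly U V)) j =
    coeff (\<Sum>j\<le>vs.dim V - vs.dim U. monom (gauss_binomial CARD('k) (vs.dim V - vs.dim U) j) j) j"
  proof (cases "j \<le> vs.dim V - vs.dim U")
    case True
    then show ?thesis
      using card_subspaces_between[OF V U True]
      by (simp add: coeff_map_poly c coeff_sum)
  next
    case False
    then have "{A \<in> subspaces_between U V. vs.dim A = vs.dim U + j} = {}"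
      using dim by fastforce
    then show ?thesis
      using False by (simp only: coeff_map_poly c) (simp add: coeff_sum)
  qed
qed

lemma palindromic_interval_poly:
  fixes U V :: "(nat \<Rightarrow> 'k::{field,finite}) set"
  assumes V: "vs.subspace V" "finite V" and U: "vs.subspace U" "U \<subseteq> V"
  shows "palindromic (vs.dim V - vs.dim U) (interval_poly U V)"
proof -
  let ?n = "vs.dim V - vs.dim U"
  have c: "rat_of_int (coeff (interval_poly U V) j)
      = (if j \<le> ?n then gauss_binomial CARD('k) ?n j else 0)" for j
    using arg_cong[OF map_poly_interval_poly[OF assms], of "\<lambda>p. coeff p j"]
    by (simp add: coeff_map_poly coeff_sum)
  have "rat_of_int (coeff (interval_poly U V) (?n - i)) = rat_of_int (coeff (interval_poly U V) i)"
    if "i \<le> ?n" for i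
    using that gauss_binomial_symmetric[OF that card_field_ge_2[where 'k = 'k]] by (simp add: c)
  moreover have "coeff (interval_poly U V) i = 0" if "?n < i" for i
    using that c[of i] by simp
  ultimately show ?thesis
    unfolding palindromic_iff_coeff by (auto intro: degree_le)
qed

section \<open>Contractions and represented matroids\<close>

lemma rk_mono: "is_matroid M \<Longrightarrow> X \<subseteq> Y \<Longrightarrow> Y \<subseteq> ground M \<Longrightarrow> rk M X \<le> rk M Y"
  unfolding is_matroid_def by blast

lemma contract_contract:
  assumes "is_matroid M" "F \<subseteq> G" "G \<subseteq> ground M"
  shows "contract (contract M F) (G - F) = contract M G"
proof -
  have "X \<union> (G - F) \<union> F = X \<union> G" "G - F \<union> F = G" for X
    using assms(2) by auto
  moreover have "rk M F \<le> rk M G"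
    using assms by (rule rk_mono)
  moreover have "ground M - F - (G - F) = ground M - G"
    using assms(2) by auto
  ultimately show ?thesis
    by (simp add: contract_def)
qed

text \<open>On sets joined with \<open>F\<close>, the two rank functions differ by the constant
  \<open>rk M F\<close>, so adding a point raises one exactly when it raises the other.\<close>

lemma flats_contract:
  assumes "is_matroid M" "F \<subseteq> ground M"
  shows "flats (contract M F) = (\<lambda>G. G - F) ` {G \<in> flats M. F \<subseteq> G}"
proof (intro equalityI subsetI)
  fix H assume H: "H \<in> flats (contract M F)"
  then have sub: "H \<subseteq> ground M - F"
    by (simp add: flats_def contract_def)
  have "rk M (H \<union> F) < rk M (insert x (H \<union> F))" if "x \<in> ground M - (H \<union> F)" for x
  proof -
    have "rk M (H \<union> F) - rk M F < rk M (insert x (H \<union> F)) - rk M F"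
      using H that by (simp add: flats_def contract_def)
    then show ?thesis by linarith
  qed
  then have "H \<union> F \<in> flats M"
    using sub assms(2) by (auto simp: flats_def)
  moreover have "H = H \<union> F - F"
    using sub by auto
  ultimately show "H \<in> (\<lambda>G. G - F) ` {G \<in> flats M. F \<subseteq> G}"
    by blast
next
  fix H assume "H \<in> (\<lambda>G. G - F) ` {G \<in> flats M. F \<subseteq> G}"
  then obtain G where G: "G \<in> flats M" "F \<subseteq> G" "H = G - F"
    by auto
  have HF: "H \<union> F = G"
    using G by auto
  have "rk M F \<le> rk M G"
    using G assms(1) by (intro rk_mono) (auto simp: flats_def)
  moreover have "rk M G < rk M (insert x G)" if "x \<in> ground M - G" for x
    using G that by (simp add: flats_def)
  ultimately have "rk M G - rk M F < rk M (insert x G) - rk M F" if "x \<in> ground M - G" for x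
    using that by (simp add: diff_less_mono)
  then show "H \<in> flats (contract M F)"
    using G HF by (auto simp: flats_def contract_def)
qed

text \<open>Expresses everything through flats and contractions of the single matroid
  \<open>M\<close>, which lets the recursion run over contractions of one fixed
  \<open>M\<close>.\<close>

lemma Z_of_contract:
  assumes "is_matroid M" "F \<subseteq> ground M"
  shows "Z_of P (contract M F)
    = (\<Sum>G | G \<in> flats M \<and> F \<subseteq> G. monom 1 (rk M G - rk M F) * P (contract M G))"
proof -
  have "inj_on (\<lambda>G. G - F) {G \<in> flats M. F \<subseteq> G}"
    by (auto simp: inj_on_def)
  then have "Z_of P (contract M F) = (\<Sum>G | G \<in> flats M \<and> F \<subseteq> G.
      monom 1 (rk (contract M F) (G - F)) * P (contract (contract M F) (G - F)))"
    by (simp add: Z_of_def flats_contract[OF assms] sum.reindex)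
  also have "\<dots> = (\<Sum>G | G \<in> flats M \<and> F \<subseteq> G. monom 1 (rk M G - rk M F) * P (contract M G))"
  proof (rule sum.cong)
    fix G assume G: "G \<in> {G \<in> flats M. F \<subseteq> G}"
    then have "contract (contract M F) (G - F) = contract M G"
      using assms by (intro contract_contract) (auto simp: flats_def)
    moreover have "G \<union> F = G"
      using G by auto
    ultimately show "monom 1 (rk (contract M F) (G - F)) * P (contract (contract M F) (G - F))
        = monom 1 (rk M G - rk M F) * P (contract M G)"
      by (simp add: contract_def)
  qed simp
  finally show ?thesis .
qed

section \<open>Projective points and their spans\<close>

lemma dim_zero_subspace: "vs.dim {0 :: nat \<Rightarrow> 'k::field} = 0"
  using vs.dim_eq_card[of "{}" "{0 :: nat \<Rightarrow> 'k}"] vs.independent_empty by simp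

lemma subspace_point_span: "vs.subspace (point_span S)"
  by (simp add: point_span_def)

lemma point_span_mono: "S \<subseteq> T \<Longrightarrow> point_span S \<subseteq> point_span T"
  unfolding point_span_def by (intro vs.span_mono) auto

lemma point_span_superset: "L \<in> S \<Longrightarrow> L \<subseteq> point_span S"
  unfolding point_span_def using vs.span_superset[of "\<Union>S"] by blast

lemma point_span_least: "vs.subspace A \<Longrightarrow> S \<subseteq> proj A \<Longrightarrow> point_span S \<subseteq> A"
  unfolding point_span_def by (intro vs.span_minimal) (auto simp: proj_def)

lemma proj_mono: "A \<subseteq> B \<Longrightarrow> proj A \<subseteq> proj B"
  by (auto simp: proj_def)

lemma proj_mem_iff: "L \<in> proj B \<Longrightarrow> L \<in> proj A \<longleftrightarrow> L \<subseteq> A"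
  by (auto simp: proj_def)

lemma flat_span_subset_iff:
  assumes "flat_span V E U" "flat_span V E W"
  shows "E \<inter> proj U \<subseteq> E \<inter> proj W \<longleftrightarrow> U \<subseteq> W"
  using assms point_span_mono[of "E \<inter> proj U" "E \<inter> proj W"] proj_mono[of U W]
  by (auto simp: flat_span_def)

section \<open>The rank function of a represented matroid\<close>

locale projective_points =
  fixes V :: "(nat \<Rightarrow> 'k::{field,finite}) set" and E :: "(nat \<Rightarrow> 'k) set set"
  assumes subspace_V: "vs.subspace V" and finite_V: "finite V" and E_sub: "E \<subseteq> proj V"
begin

lemma finite_subset_V: "A \<subseteq> V \<Longrightarrow> finite A"
  using finite_V finite_subset by blast

lemma point_span_sub: "S \<subseteq> E \<Longrightarrow> point_span S \<subseteq> V"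
  using E_sub subspace_V by (intro point_span_least) auto

lemma rk_represented: "S \<subseteq> E \<Longrightarrow> rk (represented_matroid E) S = vs.dim (point_span S)"
  by (simp add: represented_matroid_def Int_absorb2)

lemma dim_point_span_mono:
  assumes "S \<subseteq> T" "T \<subseteq> E"
  shows "vs.dim (point_span S) \<le> vs.dim (point_span T)"
  using assms point_span_sub[of T]
  by (intro dim_mono subspace_point_span point_span_mono finite_subset_V)

text \<open>The span of a union is the sum of the spans, while the span of
  \<open>S \<inter> T\<close> is only contained in the intersection of the spans; the rest is
  \<open>dim_Un_Int\<close>.\<close>

lemma dim_point_span_submodular:
  assumes "S \<subseteq> E" "T \<subseteq> E"
  shows "vs.dim (point_span (S \<union> T)) + vs.dim (point_span (S \<inter> T))
    \<le> vs.dim (point_span S) + vs.dim (point_span T)"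
proof -
  have f: "finite (point_span S)" "finite (point_span T)"
    by (intro finite_subset_V point_span_sub assms)+
  have "point_span (S \<union> T) \<subseteq> vs.span (point_span S \<union> point_span T)"
    unfolding point_span_def[of "S \<union> T"]
    using point_span_superset[of _ S] point_span_superset[of _ T] by (intro vs.span_mono) blast
  moreover have "vs.span (point_span S \<union> point_span T) \<subseteq> point_span (S \<union> T)"
    by (intro vs.span_minimal Un_least point_span_mono subspace_point_span) auto
  ultimately have "vs.dim (point_span (S \<union> T)) = vs.dim (point_span S \<union> point_span T)"
    by (metis subset_antisym vs.dim_span)
  moreover have "vs.dim (point_span (S \<inter> T)) \<le> vs.dim (point_span S \<inter> point_span T)"
    using f by (intro dim_mono vs.subspace_inter subspace_point_span Int_greatest point_span_mono) auto
  moreover have "vs.dim (point_span S \<union> point_span T) + vs.dim (point_span S \<inter> point_span T)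
      \<le> vs.dim (point_span S) + vs.dim (point_span T)"
    using f by (intro dim_Un_Int subspace_point_span)
  ultimately show ?thesis by linarith
qed

lemma dim_point_span_singleton: "L \<in> E \<Longrightarrow> vs.dim (point_span {L}) = 1"
  using E_sub by (auto simp: point_span_def proj_def)

lemma finite_E: "finite E"
  using finite_V E_sub by (intro finite_subset[of E "Pow V"]) (auto simp: proj_def)

text \<open>By submodularity, adding one point raises the rank by at most the rank of that point,
  which is 1.\<close>

lemma dim_point_span_le_card:
  assumes "S \<subseteq> E"
  shows "vs.dim (point_span S) \<le> card S"
proof -
  have "finite S"
    using assms finite_E finite_subset by blast
  then show ?thesis
    using assms
  proof (induction S rule: finite_induct)
    case (insert L S)
    then have "vs.dim (point_span ({L} \<union> S)) \<le> vs.dim (point_span {L}) + vs.dim (point_span S)"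
      using dim_point_span_submodular[of "{L}" S] by simp
    then show ?case
      using insert dim_point_span_singleton[of L] by simp
  qed (simp add: point_span_def dim_zero_subspace)
qed

lemma is_matroid_represented: "is_matroid (represented_matroid E)"
  unfolding is_matroid_def
proof (intro conjI allI impI)
  show "rk (represented_matroid E) X = rk (represented_matroid E) (X \<inter> ground (represented_matroid E))" for X
    by (simp add: represented_matroid_def)
  show "finite (ground (represented_matroid E))"
    by (simp add: represented_matroid_def finite_E)
qed (auto simp: rk_represented represented_matroid_def Int_absorb2 le_infI1
    intro!: dim_point_span_le_card dim_point_span_mono dim_point_span_submodular)

section \<open>Flats and flat spans\<close>

lemma rk_flat_span:
  "flat_span V E W \<Longrightarrow> rk (represented_matroid E) (E \<inter> proj W) = vs.dim W"
  by (simp add: rk_represented flat_span_def)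

text \<open>The span of the points of \<open>E\<close> in \<open>A\<close> stays inside
  \<open>A\<close>, so it picks up no further points of \<open>E\<close>. Hence every subspace
  \<open>A\<close> yields a flat span.\<close>

lemma Int_proj_point_span:
  "vs.subspace A \<Longrightarrow> E \<inter> proj (point_span (E \<inter> proj A)) = E \<inter> proj A"
  using point_span_least[of A "E \<inter> proj A"] point_span_superset[of _ "E \<inter> proj A"]
    proj_mono[of "point_span (E \<inter> proj A)" A] proj_mem_iff[of _ A "point_span (E \<inter> proj A)"]
  by blast

lemma flat_span_point_span: "vs.subspace A \<Longrightarrow> flat_span V E (point_span (E \<inter> proj A))"
  by (simp add: flat_span_def subspace_point_span point_span_sub Int_proj_point_span)

text \<open>A point inside the span of a flat would not raise the rank, so a flat contains all
  points of \<open>E\<close> in its span. Conversely, if a point leaves the dimension of the span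
  \<open>W\<close> unchanged, the two spans coincide and the point already lies in
  \<open>W\<close>.\<close>

lemma flats_represented:
  "flats (represented_matroid E) = (\<lambda>W. E \<inter> proj W) ` {W. flat_span V E W}"
proof (intro equalityI subsetI)
  fix G assume G: "G \<in> flats (represented_matroid E)"
  have GE: "G \<subseteq> E"
    using G by (simp add: flats_def represented_matroid_def)
  have "L \<in> G" if L: "L \<in> E" "L \<subseteq> point_span G" for L
  proof (rule ccontr)
    assume "L \<notin> G"
    then have "rk (represented_matroid E) G < rk (represented_matroid E) (insert L G)"
      using G L by (simp add: flats_def represented_matroid_def)
    moreover have "point_span (insert L G) \<subseteq> point_span G"
      using L point_span_superset[of _ G]
      unfolding point_span_def[of "insert L G"] by (intro vs.span_minimal subspace_point_span) auto
    then have "point_span (insert L G) = point_span G"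
      using point_span_mono[of G "insert L G"] by blast
    ultimately show False
      using GE L by (simp add: rk_represented)
  qed
  moreover have "L \<in> proj (point_span G) \<longleftrightarrow> L \<subseteq> point_span G" if "L \<in> E" for L
    using that E_sub by (intro proj_mem_iff) auto
  ultimately have *: "E \<inter> proj (point_span G) = G"
    using GE point_span_superset[of _ G] by auto
  then have "flat_span V E (point_span G)"
    using GE by (simp add: flat_span_def subspace_point_span point_span_sub)
  then show "G \<in> (\<lambda>W. E \<inter> proj W) ` {W. flat_span V E W}"
    using * by blast
next
  fix G assume "G \<in> (\<lambda>W. E \<inter> proj W) ` {W. flat_span V E W}"
  then obtain W where W: "flat_span V E W" "G = E \<inter> proj W"
    by auto
  have "vs.dim (point_span G) < vs.dim (point_span (insert L G))" if L: "L \<in> E" "L \<notin> G" for L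
  proof (rule ccontr)
    assume "\<not> ?thesis"
    moreover have "vs.dim (point_span G) \<le> vs.dim (point_span (insert L G))"
      using L W by (intro dim_point_span_mono) auto
    ultimately have "point_span G = point_span (insert L G)"
      using L W by (intro subspace_dim_eq subspace_point_span point_span_mono finite_subset_V point_span_sub) auto
    then have "L \<subseteq> W"
      using point_span_superset[of L "insert L G"] W by (simp add: flat_span_def)
    then show False
      using L W E_sub by (auto simp: proj_def)
  qed
  then have "rk (represented_matroid E) G < rk (represented_matroid E) (insert L G)"
    if "L \<in> E" "L \<notin> G" for L
    using that W by (simp add: rk_represented)
  then show "G \<in> flats (represented_matroid E)"
    using W by (auto simp: flats_def represented_matroid_def)
qed

text \<open>\<open>point_span\<close> inverts the passage from a flat span to its flat, and
  inclusions correspond, so the sum over flats is reindexed by flat spans with rank turned into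
  dimension.\<close>

lemma Z_of_contract_represented:
  assumes U: "flat_span V E U"
  shows "Z_of P (contract (represented_matroid E) (E \<inter> proj U))
    = (\<Sum>W | flat_span V E W \<and> U \<subseteq> W.
        monom 1 (vs.dim W - vs.dim U) * P (contract (represented_matroid E) (E \<inter> proj W)))"
proof -
  let ?M = "represented_matroid E"
  have "{G \<in> flats ?M. E \<inter> proj U \<subseteq> G} = (\<lambda>W. E \<inter> proj W) ` {W. flat_span V E W \<and> U \<subseteq> W}"
    unfolding flats_represented using flat_span_subset_iff[OF U] by blast
  moreover have "inj_on (\<lambda>W. E \<inter> proj W) {W. flat_span V E W \<and> U \<subseteq> W}"
    by (rule inj_on_inverseI[where g = point_span]) (simp add: flat_span_def)
  moreover have "E \<inter> proj U \<subseteq> ground ?M"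
    by (simp add: represented_matroid_def)
  ultimately show ?thesis
    using U by (simp add: Z_of_contract is_matroid_represented sum.reindex rk_flat_span)
qed

text \<open>Every subspace \<open>A\<close> above a flat span \<open>U\<close> contributes to exactly one \<open>C\<^sub>W\<close>, that of the span
  \<open>W\<close> of the points of \<open>E\<close> in \<open>A\<close>.\<close>

lemma sum_subspace_poly:
  assumes U: "flat_span V E U" and D: "E = proj V - D"
  shows "(\<Sum>W | flat_span V E W \<and> U \<subseteq> W. monom 1 (vs.dim W - vs.dim U) * subspace_poly V D W)
    = interval_poly U V"
proof -
  let ?T = "{W. flat_span V E W \<and> U \<subseteq> W}" and ?S = "subspaces_between U V"
  let ?g = "\<lambda>A. point_span (E \<inter> proj A)"
  have T: "vs.subspace W" "W \<subseteq> V" "point_span (E \<inter> proj W) = W" "U \<subseteq> W" if "W \<in> ?T" for W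
    using that by (auto simp: flat_span_def)
  have "monom 1 (vs.dim W - vs.dim U) * subspace_poly V D W
      = (\<Sum>A | A \<in> ?S \<and> ?g A = W. monom 1 (vs.dim A - vs.dim U))" if W: "W \<in> ?T" for W
  proof -
    \<comment> \<open>For \<open>W \<subseteq> A\<close> the condition on \<open>D\<close> says that
      all points of \<open>E\<close> in \<open>A\<close> lie in \<open>W\<close>. As
      \<open>W\<close> is spanned by its own points of \<open>E\<close>, this amounts to
      \<open>?g A = W\<close>.\<close>
    have fib: "{A. vs.subspace A \<and> W \<subseteq> A \<and> A \<subseteq> V \<and> proj A - proj W \<subseteq> D} = {A \<in> ?S. ?g A = W}"
    proof (intro equalityI subsetI)
      fix A assume "A \<in> {A. vs.subspace A \<and> W \<subseteq> A \<and> A \<subseteq> V \<and> proj A - proj W \<subseteq> D}"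
      then have A: "vs.subspace A" "W \<subseteq> A" "A \<subseteq> V" "proj A - proj W \<subseteq> D"
        by auto
      have "E \<inter> proj A = E \<inter> proj W"
        using A D proj_mono[OF A(2)] by blast
      then show "A \<in> {A \<in> ?S. ?g A = W}"
        using A T[OF W] by (simp add: subspaces_between_def)
    next
      fix A assume "A \<in> {A \<in> ?S. ?g A = W}"
      then have A: "vs.subspace A" "A \<subseteq> V" "?g A = W"
        by (auto simp: subspaces_between_def)
      have "W \<subseteq> A"
        using point_span_least[OF A(1), of "E \<inter> proj A"] A(3) by simp
      moreover have "L \<in> D" if "L \<in> proj A" "L \<notin> proj W" for L
      proof (rule ccontr)
        assume "L \<notin> D"
        then have "L \<in> E \<inter> proj A"
          using that proj_mono[OF A(2)] D by blast
        then have "L \<subseteq> W"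
          using point_span_superset A(3) by blast
        then show False
          using that proj_mem_iff[of L A W] by simp
      qed
      ultimately show "A \<in> {A. vs.subspace A \<and> W \<subseteq> A \<and> A \<subseteq> V \<and> proj A - proj W \<subseteq> D}"
        using A by auto
    qed
    \<comment> \<open>The truncated differences add up since
      \<open>U \<subseteq> W \<subseteq> A\<close>; the exponent thus no longer depends on
      \<open>W\<close>.\<close>
    have "vs.dim W - vs.dim U + (vs.dim A - vs.dim W) = vs.dim A - vs.dim U"
      if "A \<in> {A \<in> ?S. ?g A = W}" for A
    proof -
      have A: "vs.subspace A" "W \<subseteq> A" "A \<subseteq> V"
        using that unfolding fib[symmetric] by auto
      have "vs.subspace U"
        using U by (simp add: flat_span_def)
      then have "vs.dim U \<le> vs.dim W"
        by (intro dim_mono T[OF W] finite_subset_V)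
      moreover have "vs.dim W \<le> vs.dim A"
        by (intro dim_mono T[OF W] finite_subset_V A)
      ultimately show ?thesis by simp
    qed
    then show ?thesis
      unfolding subspace_poly_def fib by (simp add: sum_distrib_left mult_monom)
  qed
  then have "(\<Sum>W\<in>?T. monom 1 (vs.dim W - vs.dim U) * subspace_poly V D W)
      = (\<Sum>W\<in>?T. \<Sum>A | A \<in> ?S \<and> ?g A = W. monom 1 (vs.dim A - vs.dim U))"
    by (intro sum.cong) auto
  also have "\<dots> = (\<Sum>A\<in>?S. monom 1 (vs.dim A - vs.dim U))"
  proof (rule sum.group)
    show "finite ?S"
      using finite_V by (rule finite_subspaces_between)
    show "finite ?T"
      using finite_V by (intro finite_subset[of ?T "Pow V"]) (auto simp: flat_span_def)
    show "?g ` ?S \<subseteq> ?T"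
    proof (intro image_subsetI CollectI conjI)
      fix A assume A: "A \<in> ?S"
      then show "flat_span V E (?g A)"
        by (intro flat_span_point_span) (simp add: subspaces_between_def)
      show "U \<subseteq> ?g A"
        using A U point_span_mono[of "E \<inter> proj U" "E \<inter> proj A"] proj_mono[of U A]
        by (auto simp: subspaces_between_def flat_span_def)
    qed
  qed
  finally show ?thesis
    by (simp add: interval_poly_def)
qed

text \<open>Both \<open>Z\<close> of the contraction and \<open>interval_poly U V\<close> are palindromic of degree \<open>dim V - dim U\<close>;
  by induction on the codimension they differ by \<open>P - C\<^sub>U\<close>, whose degree is too low for a nonzero
  palindromic polynomial.\<close>

lemma KL_poly_contract_represented:
  assumes D: "E = proj V - D" and span: "point_span E = V"
    and deg: "\<And>U. flat_span V E U \<Longrightarrow> U \<noteq> V \<Longrightarrow>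
      2 * degree (subspace_poly V D U) < vs.dim V - vs.dim U"
  shows "flat_span V E U \<Longrightarrow>
    KL_poly (contract (represented_matroid E) (E \<inter> proj U)) = subspace_poly V D U"
proof (induction "vs.dim V - vs.dim U" arbitrary: U rule: less_induct)
  case less
  let ?M = "represented_matroid E"
  let ?N = "contract ?M (E \<inter> proj U)"
  let ?T = "{W. flat_span V E W \<and> U \<subseteq> W}"
  note U = less.prems
  have Usub: "vs.subspace U" "U \<subseteq> V"
    using U by (auto simp: flat_span_def)
  have flat: "E \<inter> proj U \<in> flats ?M"
    using U flats_represented by auto
  have "mrank ?M = vs.dim V"
    using span by (simp add: mrank_def represented_matroid_def)
  then have rank: "mrank ?N = vs.dim V - vs.dim U"
    using U flat by (simp add: mrank_contract rk_flat_span)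
  have KL: "(mrank ?N = 0 \<longrightarrow> KL_poly ?N = 1) \<and>
      (mrank ?N > 0 \<longrightarrow> real (degree (KL_poly ?N)) < real (mrank ?N) / 2) \<and>
      palindromic (mrank ?N) (Z_of KL_poly ?N)"
    using KL_family_KL_poly is_matroid_contract[OF is_matroid_represented flat] loopless_contract[OF flat]
    unfolding KL_family_def by blast
  show ?case
  proof (cases "U = V")
    case True
    \<comment> \<open>At the top the contraction has rank 0, and \<open>A = V\<close> contributes
      the only term of \<open>subspace_poly\<close>, so both sides are 1.\<close>
    have "{A. vs.subspace A \<and> V \<subseteq> A \<and> A \<subseteq> V \<and> proj A - proj V \<subseteq> D} = {V}"
      using subspace_V by auto
    then show ?thesis
      using KL rank True by (simp add: subspace_poly_def)
  next
    case False
    have finT: "finite ?T"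
      using finite_V by (intro finite_subset[of ?T "Pow V"]) (auto simp: flat_span_def)
    have UT: "U \<in> ?T"
      using U by simp
    have "KL_poly (contract ?M (E \<inter> proj W)) = subspace_poly V D W" if W: "W \<in> ?T - {U}" for W
    proof (rule less.hyps)
      have W': "vs.subspace W" "W \<subseteq> V" "U \<subseteq> W" "W \<noteq> U"
        using W by (auto simp: flat_span_def)
      have "vs.dim U \<le> vs.dim W" "vs.dim W \<le> vs.dim V" "vs.dim U \<noteq> vs.dim W"
        using W' Usub subspace_V finite_V finite_subset_V[of W] subspace_dim_eq[of U W]
        by (auto intro: dim_mono)
      then show "vs.dim V - vs.dim W < vs.dim V - vs.dim U"
        by linarith
    qed (use W in simp)
    \<comment> \<open>Both polynomials are sums over \<open>?T\<close>. The terms with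
      \<open>W \<noteq> U\<close> cancel by induction, and the term at \<open>W = U\<close> carries
      the monomial of degree 0.\<close>
    then have "Z_of KL_poly ?N - interval_poly U V = KL_poly ?N - subspace_poly V D U"
      unfolding Z_of_contract_represented[OF U] sum_subspace_poly[OF U D, symmetric]
        sum.remove[OF finT UT]
      by simp
    moreover have "palindromic (mrank ?N) (Z_of KL_poly ?N - interval_poly U V)"
      using KL palindromic_interval_poly[OF subspace_V finite_V Usub]
      by (auto simp: palindromic_iff_coeff rank intro: degree_diff_le)
    moreover have "2 * degree (subspace_poly V D U) < mrank ?N"
      using deg[OF U False] rank by simp
    \<comment> \<open>The strict bound just shown forces \<open>mrank ?N > 0\<close>, which
      activates the degree condition on \<open>KL_poly ?N\<close>.\<close>
    moreover from this have "2 * degree (KL_poly ?N) < mrank ?N"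
      using KL by auto
    ultimately show ?thesis
      using palindromic_low_degree[of "mrank ?N" "KL_poly ?N - subspace_poly V D U"]
        degree_diff_le_max[of "KL_poly ?N" "subspace_poly V D U"]
      by fastforce
  qed
qed

end

section \<open>Specialization to the coordinate space\<close>

theorem theorem1p1:
  fixes q r :: nat
    and V :: "(nat \<Rightarrow> 'k::{field,finite}) set"
    and D E :: "(nat \<Rightarrow> 'k) set set"
    and M :: "(nat \<Rightarrow> 'k) set matroid"
  assumes "q = CARD('k)"
    and "V = coord_space r"
    and "D \<subseteq> proj V"
    and "E = proj V - D"
    and "M = represented_matroid E"
    and "point_span E = V"
    and "\<And>U. flat_span V E U \<Longrightarrow> U \<noteq> V \<Longrightarrow>
           real (degree (subspace_poly V D U)) < (real r - real (vs.dim U)) / 2"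
  shows "(\<forall>U. flat_span V E U \<longrightarrow>
            KL_poly (contract M (E \<inter> proj U)) = subspace_poly V D U) \<and>
         map_poly rat_of_int (Z_poly M) = (\<Sum>j\<le>r. monom (gauss_binomial q r j) j)"
proof -
  interpret projective_points V E
    using assms(2,4) by unfold_locales (auto simp: subspace_coord_space finite_coord_space)
  have dimV: "vs.dim V = r"
    using assms(2) by (simp add: dim_coord_space)
  have KL: "KL_poly (contract M (E \<inter> proj U)) = subspace_poly V D U" if U: "flat_span V E U" for U
    unfolding assms(5)
  proof (rule KL_poly_contract_represented[OF assms(4,6) _ U])
    fix W assume W: "flat_span V E W" "W \<noteq> V"
    \<comment> \<open>This inequality lets the real-valued degree hypothesis be read with
      natural-number subtraction.\<close>
    then have "vs.dim W \<le> vs.dim V"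
      using subspace_V finite_V by (intro dim_mono) (auto simp: flat_span_def)
    then show "2 * degree (subspace_poly V D W) < vs.dim V - vs.dim W"
      using assms(7)[OF W] dimV by (simp add: field_simps)
  qed
  have proj0: "proj {0 :: nat \<Rightarrow> 'k} = {}"
    by (auto simp: proj_def subset_singleton_iff dim_zero_subspace dest: vs.subspace_0)
  \<comment> \<open>The zero subspace contains no points and is the span of none. Its flat is empty,
    and contracting it returns \<open>M\<close>, so \<open>Z_poly M\<close> is the case
    \<open>U = {0}\<close>.\<close>
  have zero: "flat_span V E {0}"
    using subspace_V by (simp add: flat_span_def proj0 point_span_def vs.subspace_0)
  have "M = contract M (E \<inter> proj {0})"
    by (simp add: proj0 contract_empty is_matroid_represented assms(5))
  then have "Z_poly M = (\<Sum>W | flat_span V E W \<and> {0} \<subseteq> W.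
      monom 1 (vs.dim W - vs.dim {0::nat \<Rightarrow> 'k}) * KL_poly (contract M (E \<inter> proj W)))"
    using Z_of_contract_represented[OF zero, of KL_poly] unfolding Z_poly_def assms(5) by simp
  also have "\<dots> = interval_poly {0} V"
    \<comment> \<open>Replacing each Kazhdan--Lusztig polynomial by its \<open>subspace_poly\<close>
      gives exactly the grouped sum over all subspaces of \<open>V\<close>.\<close>
    by (simp add: KL flip: sum_subspace_poly[OF zero assms(4)])
  finally have "Z_poly M = interval_poly {0} V" .
  then show ?thesis
    using KL map_poly_interval_poly[OF subspace_V finite_V, of "{0}"] subspace_V dimV assms(1)
    by (simp add: vs.subspace_0 dim_zero_subspace)
qed

end
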